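(* Let $n\ge 2$, let $K,L\in\mathcal S^n$ be star bodies in $\mathbb R^n$, let $i$ be an integer with $0\le i<n$, let $\phi\in\Phi_2$, and let $K\check{+}_\phi L$ be the Orlicz chord addition of $K$ and $L$, i.e. a star body whose half-chord function satisfies $$\phi\!\left(\frac{d(K,u)}{d(K\check{+}_\phi L,u)},\frac{d(L,u)}{d(K\check{+}_\phi L,u)}\right)=1\quad\text{for all }u\in S^{n-1}.$$ Then $$1\ \ge\ \phi\!\left(\left(\frac{B_i(K)}{B_i(K\check{+}_\phi L)}\right)^{1/(n-i)},\left(\frac{B_i(L)}{B_i(K\check{+}_\phi L)}\right)^{1/(n-i)}\right).$$ If moreover $\phi$ is strictly convex (on $(0,\infty)^2$), then equality holds if and only if $K$ and $L$ have similar chord.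
   Context: $S^{n-1}$ is the unit sphere of $\mathbb R^n$ and $dS$ is its spherical Lebesgue measure. For a compact set $K\subset\mathbb R^n$ that contains the origin and is star-shaped with respect to it, the radial function is $\rho(K,u)=\max\{c\ge 0: cu\in K\}$, $u\in S^{n-1}$. $K$ is a star body if $\rho(K,\cdot)$ is positive and continuous on $S^{n-1}$; $\mathcal S^n$ is the set of star bodies. The half chord of $K$ in direction $u$ is $d(K,u)=\tfrac12(\rho(K,u)+\rho(K,-u))$. $K$ and $L$ have similar chord if there is a constant $\lambda>0$ with $d(K,u)=\lambda d(L,u)$ for all $u\in S^{n-1}$. The chord integral is $B_i(K)=\frac1n\int_{S^{n-1}}d(K,u)^{n-i}\,dS(u)$; it depends on $K$ only through $d(K,\cdot)$. The Orlicz chord addition is specified only through its half-chord function, and the statement holds for any star body with that half-chord function. $\Phi_2$ is the set of convex functions $\phi:[0,\infty)^2\to(0,\infty]$, finite on $(0,\infty)^2$, that are decreasing in each variable (strictly on $(0,\infty)^2$), with $\phi(0,0)=\infty$ and $\lim_{x\to\infty}\phi(x,1)=\lim_{x\to\infty}\phi(1,x)=1$. *)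

theory Defs
  imports "HOL-Analysis.Analysis"
begin

text \<open>The spherical Lebesgue measure, as the normalised cone measure: a Borel subset \<open>A\<close> of the
  unit sphere has measure \<open>n\<close> times the volume of the cone \<open>{r u | 0 < r < 1, u \<in> A}\<close>
  (lemma \<open>emeasure_sphere_measure\<close>).\<close>

definition sphere_measure :: "'a::euclidean_space measure" where
  "sphere_measure = scale_measure (of_nat DIM('a))
     (distr (restrict_space lborel (ball 0 1 - {0})) (restrict_space borel (sphere 0 1)) sgn)"

lemma space_sphere_measure [simp]: "space sphere_measure = sphere (0::'a::euclidean_space) 1"
  by (simp add: sphere_measure_def space_scale_measure space_restrict_space)

lemma sets_sphere_measure [simp, measurable_cong]:
  "sets (sphere_measure :: 'a::euclidean_space measure) = sets (restrict_space borel (sphere 0 1))"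
  by (simp add: sphere_measure_def)

lemma emeasure_sphere_measure:
  fixes A :: "'a::euclidean_space set"
  assumes A: "A \<in> sets borel" "A \<subseteq> sphere 0 1"
  shows "emeasure sphere_measure A
    = of_nat DIM('a) * emeasure lborel {r *\<^sub>R u | r u. 0 < r \<and> r < 1 \<and> u \<in> A}"
proof -
  have sgn_meas: "(sgn :: 'a \<Rightarrow> 'a) \<in> measurable (restrict_space lborel (ball 0 1 - {0}))
      (restrict_space borel (sphere 0 1))"
    by (intro measurable_restrict_space2 measurable_restrict_space1)
       (auto simp: space_restrict_space norm_sgn sgn_div_norm)
  have A': "A \<in> sets (restrict_space borel (sphere 0 1))"
    using A by (auto simp: sets_restrict_space)
  have cone: "sgn -` A \<inter> (ball 0 1 - {0}) = {r *\<^sub>R u | r u. 0 < r \<and> r < 1 \<and> u \<in> A}" (is "?L = ?R")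
  proof
    show "?L \<subseteq> ?R"
    proof
      fix x assume x: "x \<in> ?L"
      then have "x = norm x *\<^sub>R sgn x" "0 < norm x" "norm x < 1" "sgn x \<in> A"
        by (auto simp: sgn_div_norm)
      then show "x \<in> ?R" by blast
    qed
    show "?R \<subseteq> ?L"
      using A(2) by (auto simp: sgn_div_norm subset_iff)
  qed
  have "emeasure (distr (restrict_space lborel (ball 0 1 - {0})) (restrict_space borel (sphere 0 1)) sgn) A
     = emeasure (restrict_space lborel (ball 0 1 - {0})) (sgn -` A \<inter> (ball 0 1 - {0}))"
    using emeasure_distr[OF sgn_meas A'] by (simp add: space_restrict_space)
  also have "\<dots> = emeasure lborel (sgn -` A \<inter> (ball 0 1 - {0}))"
    by (subst emeasure_restrict_space) auto
  finally show ?thesis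
    by (simp add: sphere_measure_def cone)
qed

text \<open>For compact \<open>K\<close> containing the origin the supremum is attained, i.e. it is the maximum.\<close>

definition radial :: "'a::euclidean_space set \<Rightarrow> 'a \<Rightarrow> real" where
  "radial K u = Sup {c. 0 \<le> c \<and> c *\<^sub>R u \<in> K}"

lemma radial_is_max:
  fixes K :: "'a::euclidean_space set"
  assumes "compact K" "0 \<in> K" "u \<in> sphere 0 1"
  shows "0 \<le> radial K u" "radial K u *\<^sub>R u \<in> K" 
    "\<And>c. 0 \<le> c \<Longrightarrow> c *\<^sub>R u \<in> K \<Longrightarrow> c \<le> radial K u"
proof -
  let ?C = "{c. 0 \<le> c \<and> c *\<^sub>R u \<in> K}"
  have "0 \<in> ?C" using assms by auto
  then have ne: "?C \<noteq> {}" by blast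
  obtain M where M: "\<And>x. x \<in> K \<Longrightarrow> norm x \<le> M"
    using compact_imp_bounded[OF assms(1)] by (auto simp: bounded_iff)
  have bdd: "bdd_above ?C"
    using M assms(3) by (intro bdd_aboveI[where M = M]) fastforce
  have "?C = {0..} \<inter> (\<lambda>c. c *\<^sub>R u) -` K" by auto
  moreover have "closed ((\<lambda>c. c *\<^sub>R u) -` K)"
    by (intro closed_vimage compact_imp_closed assms(1) continuous_intros)
  ultimately have "closed ?C" by (simp add: closed_Int)
  from closed_contains_Sup[OF ne bdd this] show "0 \<le> radial K u" "radial K u *\<^sub>R u \<in> K"
    by (auto simp: radial_def)
  show "c \<le> radial K u" if "0 \<le> c" "c *\<^sub>R u \<in> K" for c
    unfolding radial_def using that bdd by (intro cSup_upper) auto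
qed

definition star_body :: "'a::euclidean_space set \<Rightarrow> bool" where
  "star_body K \<longleftrightarrow> compact K \<and> 0 \<in> K \<and> (\<forall>x\<in>K. closed_segment 0 x \<subseteq> K) \<and>
     (\<forall>u\<in>sphere 0 1. 0 < radial K u) \<and> continuous_on (sphere 0 1) (radial K)"

definition half_chord :: "'a::euclidean_space set \<Rightarrow> 'a \<Rightarrow> real" where
  "half_chord K u = (radial K u + radial K (- u)) / 2"

definition similar_chord :: "'a::euclidean_space set \<Rightarrow> 'a set \<Rightarrow> bool" where
  "similar_chord K L \<longleftrightarrow> (\<exists>c>0. \<forall>u\<in>sphere 0 1. half_chord K u = c * half_chord L u)"

text \<open>Used for \<open>i < n\<close> only, so the subtraction in the exponent does not truncate.\<close>

definition chord_integral :: "nat \<Rightarrow> 'a::euclidean_space set \<Rightarrow> real" where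
  "chord_integral i K =
     1 / real DIM('a) * (\<integral>u. half_chord K u ^ (DIM('a) - i) \<partial>sphere_measure)"

text \<open>Convexity of extended-real-valued functions; restricting to \<open>0 < t < 1\<close> avoids
  products of \<open>0\<close> and \<open>\<infinity>\<close>.\<close>

definition ereal_convex_on :: "'a::real_vector set \<Rightarrow> ('a \<Rightarrow> ereal) \<Rightarrow> bool" where
  "ereal_convex_on S f \<longleftrightarrow> convex S \<and> (\<forall>x\<in>S. \<forall>y\<in>S. \<forall>t::real. 0 < t \<longrightarrow> t < 1 \<longrightarrow>
     f ((1 - t) *\<^sub>R x + t *\<^sub>R y) \<le> ereal (1 - t) * f x + ereal t * f y)"

definition ereal_strictly_convex_on :: "'a::real_vector set \<Rightarrow> ('a \<Rightarrow> ereal) \<Rightarrow> bool" where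
  "ereal_strictly_convex_on S f \<longleftrightarrow> convex S \<and> (\<forall>x\<in>S. \<forall>y\<in>S. \<forall>t::real. x \<noteq> y \<longrightarrow> 0 < t \<longrightarrow> t < 1 \<longrightarrow>
     f ((1 - t) *\<^sub>R x + t *\<^sub>R y) < ereal (1 - t) * f x + ereal t * f y)"

text \<open>The class \<open>\<Phi>\<^sub>2\<close>. Only the values on \<open>[0,\<infinity>)\<^sup>2\<close> are meaningful.\<close>

definition Phi2 :: "(real \<times> real \<Rightarrow> ereal) set" where
  "Phi2 = {\<phi>.
     (\<forall>z\<in>{0..} \<times> {0..}. 0 < \<phi> z) \<and>
     (\<forall>z\<in>{0<..} \<times> {0<..}. \<phi> z < \<infinity>) \<and>
     ereal_convex_on ({0..} \<times> {0..}) \<phi> \<and>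
     (\<forall>y\<ge>0. antimono_on {0..} (\<lambda>x. \<phi> (x, y))) \<and>
     (\<forall>x\<ge>0. antimono_on {0..} (\<lambda>y. \<phi> (x, y))) \<and>
     (\<forall>y>0. monotone_on {0<..} (<) (>) (\<lambda>x. \<phi> (x, y))) \<and>
     (\<forall>x>0. monotone_on {0<..} (<) (>) (\<lambda>y. \<phi> (x, y))) \<and>
     \<phi> (0, 0) = \<infinity> \<and>
     ((\<lambda>x. \<phi> (x, 1)) \<longlongrightarrow> 1) at_top \<and>
     ((\<lambda>x. \<phi> (1, x)) \<longlongrightarrow> 1) at_top}"

text \<open>The Orlicz chord sum is determined only up to its half-chord function, hence a relation:
  \<open>P\<close> is a star body that is an Orlicz chord sum of \<open>K\<close> and \<open>L\<close>.\<close>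

definition orlicz_chord_sum ::
  "(real \<times> real \<Rightarrow> ereal) \<Rightarrow> 'a::euclidean_space set \<Rightarrow> 'a set \<Rightarrow> 'a set \<Rightarrow> bool" where
  "orlicz_chord_sum \<phi> K L P \<longleftrightarrow> star_body P \<and>
     (\<forall>u\<in>sphere 0 1. \<phi> (half_chord K u / half_chord P u, half_chord L u / half_chord P u) = 1)"

end

theory Submission
  imports Defs "HOL-Probability.Probability_Measure"
begin

text \<open>Write \<open>a\<close>, \<open>b\<close>, \<open>h\<close> for the half-chord functions of \<open>K\<close>, \<open>L\<close>, \<open>P\<close>, and \<open>p = n - i\<close>. Under the
  probability measure \<open>h\<^sup>p dS / \<integral> h\<^sup>p dS\<close> the two arguments of \<open>\<phi>\<close> are the \<open>L\<^sup>p\<close>-norms of \<open>X = a / h\<close> and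
  \<open>Y = b / h\<close>. They dominate the means of \<open>X\<close> and \<open>Y\<close>, so monotonicity of \<open>\<phi>\<close> followed by Jensen's
  inequality for \<open>\<phi>(X, Y) = 1\<close> bounds the value by \<open>1\<close>. For strictly convex \<open>\<phi>\<close>, equality makes
  \<open>(X, Y)\<close> constant almost everywhere, hence everywhere by continuity; conversely, if \<open>X\<close> is a multiple
  of \<open>Y\<close>, then \<open>\<phi>(X, Y) = 1\<close> and strict monotonicity force both to be constant.\<close>

section \<open>Supporting hyperplanes and Jensen's inequality in Euclidean space\<close>

text \<open>Separate \<open>(x, f x)\<close> from the strict epigraph of \<open>f\<close>, a convex
  set that does not contain this point. Openness of \<open>S\<close> keeps the separating hyperplane
  from being vertical, so dividing its normal by the last coordinate gives the slope.\<close>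

lemma convex_on_subgradient:
  fixes f :: "'a::euclidean_space \<Rightarrow> real"
  assumes f: "convex_on S f" and "open S" "x \<in> S"
  obtains s where "\<And>y. y \<in> S \<Longrightarrow> f x + s \<bullet> (y - x) \<le> f y"
proof -
  let ?E = "{(y, t). y \<in> S \<and> f y < t}"
  have "convex ?E"
    unfolding convex_alt
  proof (intro ballI allI impI)
    fix p q and u :: real
    assume "p \<in> ?E" "q \<in> ?E" "0 \<le> u \<and> u \<le> 1"
    then obtain y t z r where pq: "p = (y, t)" "q = (z, r)"
      and *: "y \<in> S" "f y < t" "z \<in> S" "f z < r" and u: "0 \<le> u" "u \<le> 1"
      by blast
    have "f ((1 - u) *\<^sub>R y + u *\<^sub>R z) \<le> (1 - u) * f y + u * f z"
      using convex_onD[OF f] * u by blast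
    also have "\<dots> < (1 - u) * t + u * r"
    proof (cases "u = 0")
      case False
      then have "u * f z < u * r" using * u by simp
      moreover have "(1 - u) * f y \<le> (1 - u) * t" using * u by (intro mult_left_mono) auto
      ultimately show ?thesis by linarith
    qed (use * in simp)
    moreover have "(1 - u) *\<^sub>R y + u *\<^sub>R z \<in> S"
      using convex_on_imp_convex[OF f] * u by (simp add: convex_alt)
    ultimately show "(1 - u) *\<^sub>R p + u *\<^sub>R q \<in> ?E"
      by (simp add: pq)
  qed
  moreover have "(x, f x + 1) \<in> ?E"
    using \<open>x \<in> S\<close> by simp
  then have "?E \<noteq> {}"
    by blast
  moreover have "(x, f x) \<notin> ?E"
    by simp
  ultimately obtain a b where a: "a \<noteq> 0" "a \<bullet> (x, f x) \<le> b" "\<forall>z\<in>?E. b \<le> a \<bullet> z"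
    by (rule separating_hyperplane_set_point_inaff) blast
  obtain v c where vc: "a = (v, c)"
    by fastforce
  have le: "v \<bullet> x + c * f x \<le> v \<bullet> y + c * t" if "y \<in> S" "f y < t" for y t
    using a(2) bspec[OF a(3), of "(y, t)"] that by (simp add: vc)
  have "0 \<le> c"
    using le[of x "f x + 1"] \<open>x \<in> S\<close> by (simp add: algebra_simps)
  \<comment> \<open>For \<open>c = 0\<close> the functional \<open>v\<close> would attain its
    minimum over \<open>S\<close> at \<open>x\<close>, but a step of length \<open>e\<close> from
    \<open>x\<close> against \<open>v\<close> stays in \<open>S\<close> and lowers it.\<close>
  have "c \<noteq> 0"
  proof
    assume "c = 0"
    then have "v \<noteq> 0"
      using a(1) by (simp add: vc zero_prod_def)
    obtain e where e: "0 < e" "cball x e \<subseteq> S"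
      using \<open>open S\<close> \<open>x \<in> S\<close> open_contains_cball by blast
    have "x - (e / norm v) *\<^sub>R v \<in> S"
      using e \<open>v \<noteq> 0\<close> by (intro subsetD[OF e(2)]) (simp add: dist_norm)
    from le[OF this, of "f (x - (e / norm v) *\<^sub>R v) + 1"] have "(e / norm v) * (v \<bullet> v) \<le> 0"
      using \<open>c = 0\<close> by (simp add: inner_diff_right)
    moreover have "(e / norm v) * (v \<bullet> v) > 0"
      using e(1) \<open>v \<noteq> 0\<close> by (intro mult_pos_pos) simp_all
    ultimately show False
      by linarith
  qed
  with \<open>0 \<le> c\<close> have "0 < c"
    by simp
  have "f x + (- (1 / c) *\<^sub>R v) \<bullet> (y - x) \<le> f y" if "y \<in> S" for y
  proof -
    \<comment> \<open>The epigraph is strict, so only heights above \<open>f y\<close> are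
      admissible; the excess \<open>e / c\<close> costs exactly \<open>e\<close> after
      multiplication by \<open>c\<close>, and \<open>e\<close> is arbitrary.\<close>
    have "v \<bullet> x + c * f x \<le> v \<bullet> y + c * f y + e" if "0 < e" for e
      using le[OF \<open>y \<in> S\<close>, of "f y + e / c"] that \<open>0 < c\<close> by (simp add: distrib_left)
    then have "v \<bullet> x + c * f x \<le> v \<bullet> y + c * f y"
      by (rule field_le_epsilon)
    then show ?thesis
      using \<open>0 < c\<close> by (simp add: field_simps inner_diff_right)
  qed
  then show ?thesis
    by (rule that)
qed

context prob_space
begin

text \<open>Integrate the affine minorant \<open>g\<close> that supports \<open>f\<close> at the
  mean; its expectation is the value of \<open>f\<close> there. Under equality \<open>f\<close>
  agrees with \<open>g\<close> at almost every value of \<open>X\<close>, which strict midpoint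
  convexity allows only at the mean.\<close>

lemma jensens_inequality_euclidean:
  fixes X :: "'a \<Rightarrow> 'b::euclidean_space" and f :: "'b \<Rightarrow> real"
  assumes X: "integrable M X" "AE \<omega> in M. X \<omega> \<in> S" and S: "open S" "expectation X \<in> S"
    and f: "convex_on S f" "integrable M (\<lambda>\<omega>. f (X \<omega>))"
  shows "f (expectation X) \<le> expectation (\<lambda>\<omega>. f (X \<omega>))"
    and "\<lbrakk>\<And>x y. x \<in> S \<Longrightarrow> y \<in> S \<Longrightarrow> x \<noteq> y \<Longrightarrow> f ((1/2) *\<^sub>R x + (1/2) *\<^sub>R y) < (f x + f y) / 2;
          f (expectation X) = expectation (\<lambda>\<omega>. f (X \<omega>))\<rbrakk> \<Longrightarrow> AE \<omega> in M. X \<omega> = expectation X"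
proof -
  define m where "m = expectation X"
  obtain s where s: "\<And>y. y \<in> S \<Longrightarrow> f m + s \<bullet> (y - m) \<le> f y"
    using convex_on_subgradient[OF f(1) S] unfolding m_def by blast
  define g where "g \<omega> = f m + s \<bullet> (X \<omega> - m)" for \<omega>
  have g_eq: "g = (\<lambda>\<omega>. (f m - s \<bullet> m) + s \<bullet> X \<omega>)"
    by (auto simp: g_def inner_diff_right)
  have g: "integrable M g" "expectation g = f m"
    using X(1) by (simp_all add: g_eq m_def[symmetric] prob_space)
  have gf: "AE \<omega> in M. g \<omega> \<le> f (X \<omega>)"
    using X(2) by eventually_elim (auto simp: g_def s)
  show "f (expectation X) \<le> expectation (\<lambda>\<omega>. f (X \<omega>))"
    using integral_mono_AE[OF g(1) f(2) gf] g(2) by (simp add: m_def)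
  assume strict: "\<And>x y. x \<in> S \<Longrightarrow> y \<in> S \<Longrightarrow> x \<noteq> y \<Longrightarrow>
      f ((1/2) *\<^sub>R x + (1/2) *\<^sub>R y) < (f x + f y) / 2"
    and eq: "f (expectation X) = expectation (\<lambda>\<omega>. f (X \<omega>))"
  \<comment> \<open>A nonnegative function with integral zero vanishes almost everywhere.\<close>
  have "AE \<omega> in M. f (X \<omega>) - g \<omega> = 0"
    using g f(2) gf eq by (subst integral_nonneg_eq_0_iff_AE[symmetric]) (auto simp: m_def)
  with X(2) have "AE \<omega> in M. X \<omega> = m"
  proof eventually_elim
    case (elim \<omega>)
    show ?case
    proof (rule ccontr)
      assume "X \<omega> \<noteq> m"
      have m: "m \<in> S"
        using S by (simp add: m_def)
      \<comment> \<open>At the midpoint the affine minorant equals the average of \<open>f m\<close>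
        and \<open>f (X \<omega>)\<close>, while strict convexity puts \<open>f\<close> below that
        average.\<close>
      let ?z = "(1/2) *\<^sub>R m + (1/2) *\<^sub>R X \<omega>"
      have "?z \<in> S"
        using convexD[OF convex_on_imp_convex[OF f(1)] m elim(1), of "1/2" "1/2"] by simp
      moreover have "?z - m = (1/2) *\<^sub>R (X \<omega> - m)"
        by (simp add: algebra_simps flip: scaleR_left_distrib)
      ultimately have "f m + (s \<bullet> (X \<omega> - m)) / 2 \<le> f ?z"
        using s[of ?z] by simp
      also have "\<dots> < (f m + f (X \<omega>)) / 2"
        using strict[OF m elim(1)] \<open>X \<omega> \<noteq> m\<close> by simp
      finally show False
        using elim(2) by (simp add: g_def)
    qed
  qed
  then show "AE \<omega> in M. X \<omega> = expectation X"
    by (simp add: m_def)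
qed

end

section \<open>Spherical measure and half-chord functions\<close>

lemma finite_measure_sphere_measure: "finite_measure (sphere_measure :: 'a::euclidean_space measure)"
proof (rule finite_measureI)
  have "emeasure lborel {r *\<^sub>R u | r u. 0 < r \<and> r < 1 \<and> u \<in> sphere (0::'a) 1}
      \<le> emeasure lborel (ball (0::'a) 1)"
    by (intro emeasure_mono) auto
  also have "\<dots> < \<infinity>"
    by (intro emeasure_bounded_finite) simp
  finally show "emeasure (sphere_measure :: 'a measure) (space sphere_measure) \<noteq> \<infinity>"
    by (simp add: emeasure_sphere_measure ennreal_mult_eq_top_iff less_top of_nat_less_top)
qed

lemma borel_measurable_sphere_measure:
  fixes f :: "'a::euclidean_space \<Rightarrow> 'b::topological_space"
  assumes "continuous_on (sphere 0 1) f"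
  shows "f \<in> borel_measurable sphere_measure"
  using borel_measurable_continuous_on_restrict[OF assms]
    measurable_cong_sets[OF sets_sphere_measure refl] by blast

lemma integrable_sphere_measure:
  fixes f :: "'a::euclidean_space \<Rightarrow> 'b::{banach, second_countable_topology}"
  assumes "continuous_on (sphere 0 1) f"
  shows "integrable sphere_measure f"
proof -
  have "bounded (f ` sphere 0 1)"
    by (intro compact_imp_bounded compact_continuous_image assms) simp
  then obtain B where "\<forall>u\<in>sphere 0 1. norm (f u) \<le> B"
    by (auto simp: bounded_iff)
  then show ?thesis
    by (intro finite_measure.integrable_const_bound[OF finite_measure_sphere_measure, where B = B]
        borel_measurable_sphere_measure assms AE_I2) simp
qed

text \<open>Nonempty relatively open subsets of the sphere have positive measure, because the cone
  over such a set is open and nonempty in the whole space. The set where a continuous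
  \<open>f\<close> differs from \<open>c\<close> is relatively open.\<close>

lemma AE_sphere_measure_imp_all:
  fixes f :: "'a::euclidean_space \<Rightarrow> 'b::t2_space"
  assumes f: "continuous_on (sphere 0 1) f" and ae: "AE u in sphere_measure. f u = c"
    and u: "u \<in> sphere 0 1"
  shows "f u = c"
proof (rule ccontr)
  assume "f u \<noteq> c"
  let ?A = "sphere 0 1 \<inter> f -` (- {c})"
  let ?C = "{r *\<^sub>R u | r u. 0 < r \<and> r < 1 \<and> u \<in> ?A}"
  have op: "openin (top_of_set (sphere 0 1)) ?A"
    using f by (intro continuous_openin_preimage_gen) auto
  then have A: "?A \<in> sets borel"
    by (metis borel_open borel_closed closed_sphere openin_open sets.Int)
  \<comment> \<open>As a preimage under \<open>sgn\<close>, which is continuous away from the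
    origin, the cone inherits openness from \<open>?A\<close>.\<close>
  have C: "?C = (ball 0 1 - {0}) \<inter> sgn -` ?A"
  proof (intro equalityI subsetI)
    fix x assume "x \<in> (ball 0 1 - {0}) \<inter> sgn -` ?A"
    then have "x = norm x *\<^sub>R sgn x" "0 < norm x" "norm x < 1" "sgn x \<in> ?A"
      by (auto simp: sgn_div_norm)
    then show "x \<in> ?C" by blast
  qed (auto simp: sgn_div_norm)
  have "continuous_on (ball 0 1 - {0::'a}) sgn"
    by (intro continuous_intros) auto
  moreover have "sgn \<in> (ball 0 1 - {0::'a}) \<rightarrow> sphere 0 1"
    by (auto simp: norm_sgn)
  ultimately have "openin (top_of_set (ball 0 1 - {0})) ?C"
    unfolding C using op by (rule continuous_openin_preimage)
  then have "open ?C"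
    by (rule openin_open_trans) (intro open_Diff open_ball closed_singleton)
  moreover have "(1/2) *\<^sub>R u \<in> ?C"
    using u \<open>f u \<noteq> c\<close> by (intro CollectI exI[of _ "1/2"] exI[of _ u]) auto
  ultimately have "?C \<notin> null_sets lborel" "?C \<in> sets lborel"
    using open_not_negligible[of ?C] null_sets_completionI[of ?C lborel]
    by (auto simp only: negligible_iff_null_sets sets_lborel borel_open)
  then have "emeasure lborel ?C \<noteq> 0"
    by (auto simp only: null_sets_def)
  then have "emeasure sphere_measure ?A \<noteq> 0"
    by (simp only: emeasure_sphere_measure[OF A inf_le1]) simp
  moreover have "{u \<in> space sphere_measure. f u \<noteq> c} = ?A"
    by auto
  moreover have "?A \<in> sets sphere_measure"
    using A by (auto simp: sets_restrict_space)
  ultimately show False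
    using ae by (simp add: AE_iff_measurable[OF _ refl])
qed

lemma star_body_half_chord:
  assumes "star_body K"
  shows continuous_on_half_chord: "continuous_on (sphere 0 1) (half_chord K)"
    and half_chord_pos: "u \<in> sphere 0 1 \<Longrightarrow> 0 < half_chord K u"
proof -
  have *: "continuous_on (sphere 0 1) (radial K)"
    using assms by (simp add: star_body_def)
  moreover have "continuous_on (sphere 0 1) (\<lambda>u. radial K (- u))"
    by (rule continuous_on_compose2[OF *]) (auto intro: continuous_intros)
  ultimately show "continuous_on (sphere 0 1) (half_chord K)"
    unfolding half_chord_def by (intro continuous_intros) auto
  show "0 < half_chord K u" if "u \<in> sphere 0 1"
    using assms that unfolding star_body_def half_chord_def
    by (smt (verit, best) half_gt_zero mem_sphere_0 norm_minus_cancel)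
qed


section \<open>Power means and the class \<open>Phi2\<close>\<close>

lemma powr_inverse_power_mean_ge:
  fixes x m :: real
  assumes "0 < x" "x ^ p \<le> m" "0 < p"
  shows "x \<le> m powr (1 / real p)"
proof -
  have "x = (x ^ p) powr (1 / real p)"
    using assms by (simp add: powr_powr flip: powr_realpow)
  also have "\<dots> \<le> m powr (1 / real p)"
    using assms by (intro powr_mono2) auto
  finally show ?thesis .
qed

context
  fixes \<phi> :: "real \<times> real \<Rightarrow> ereal"
  assumes \<phi>: "\<phi> \<in> Phi2"
begin

text \<open>On the open quadrant \<open>\<phi>\<close> is positive and finite, so the passage to
  real values, where the Jensen inequality is stated, loses nothing.\<close>

lemma Phi2_real:
  assumes "z \<in> {0<..} \<times> {0<..}"
  shows "ereal (real_of_ereal (\<phi> z)) = \<phi> z"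
proof -
  have "0 < \<phi> z" "\<phi> z < \<infinity>"
    using \<phi> assms by (auto simp: Phi2_def)
  then show ?thesis
    by (intro ereal_real') auto
qed

lemma convex_on_Phi2: "convex_on ({0<..} \<times> {0<..}) (\<lambda>z. real_of_ereal (\<phi> z))"
proof (rule convex_onI)
  show cvx: "convex ({0::real<..} \<times> {0::real<..})"
    by (intro convex_Times convex_real_interval)
  fix t :: real and x y :: "real \<times> real"
  assume t: "0 < t" "t < 1" and xy: "x \<in> {0<..} \<times> {0<..}" "y \<in> {0<..} \<times> {0<..}"
  let ?z = "(1 - t) *\<^sub>R x + t *\<^sub>R y"
  have "?z \<in> {0<..} \<times> {0<..}"
    using convexD_alt[OF cvx xy] t by simp
  moreover have "\<phi> ?z \<le> ereal (1 - t) * \<phi> x + ereal t * \<phi> y"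
    using \<phi> t xy by (force simp: Phi2_def ereal_convex_on_def)
  ultimately have "ereal (real_of_ereal (\<phi> ?z))
      \<le> ereal (1 - t) * ereal (real_of_ereal (\<phi> x)) + ereal t * ereal (real_of_ereal (\<phi> y))"
    using xy by (simp only: Phi2_real)
  then show "real_of_ereal (\<phi> ?z) \<le> (1 - t) * real_of_ereal (\<phi> x) + t * real_of_ereal (\<phi> y)"
    by simp
qed

text \<open>The case \<open>t = 1/2\<close> of strict convexity, in the real-valued form that the
  equality case of Jensen's inequality takes.\<close>

lemma strictly_convex_Phi2_midpoint:
  assumes "ereal_strictly_convex_on ({0<..} \<times> {0<..}) \<phi>"
    and xy: "x \<in> {0<..} \<times> {0<..}" "y \<in> {0<..} \<times> {0<..}" "x \<noteq> y"
  shows "real_of_ereal (\<phi> ((1/2) *\<^sub>R x + (1/2) *\<^sub>R y))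
    < (real_of_ereal (\<phi> x) + real_of_ereal (\<phi> y)) / 2"
proof -
  have "\<phi> ((1 - 1/2) *\<^sub>R x + (1/2) *\<^sub>R y) < ereal (1 - 1/2) * \<phi> x + ereal (1/2) * \<phi> y"
    using assms unfolding ereal_strictly_convex_on_def by (metis half_gt_zero_iff zero_less_one
      field_sum_of_halves less_add_same_cancel1)
  moreover have "(1/2) *\<^sub>R x + (1/2) *\<^sub>R y \<in> {0<..} \<times> {0<..}"
    using xy by (auto intro!: add_pos_pos)
  ultimately have "ereal (real_of_ereal (\<phi> ((1/2) *\<^sub>R x + (1/2) *\<^sub>R y)))
      < ereal (1/2) * ereal (real_of_ereal (\<phi> x)) + ereal (1/2) * ereal (real_of_ereal (\<phi> y))"
    using xy by (simp only: Phi2_real) simp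
  then show ?thesis
    by simp
qed

lemma Phi2_antimono:
  assumes "0 \<le> x" "x \<le> x'" "0 \<le> y" "y \<le> y'"
  shows "\<phi> (x', y') \<le> \<phi> (x, y)"
proof -
  have "\<phi> (x', y') \<le> \<phi> (x, y')" "\<phi> (x, y') \<le> \<phi> (x, y)"
    using \<phi> assms by (auto simp: Phi2_def monotone_on_def)
  then show ?thesis
    by (rule order_trans)
qed

text \<open>Change one coordinate at a time: the intermediate point \<open>(x, y')\<close> stays in
  the open quadrant, where strictness is available.\<close>

lemma Phi2_strict_antimono:
  assumes "0 < x" "x < x'" "0 < y" "y < y'"
  shows "\<phi> (x', y') < \<phi> (x, y)"
proof -
  have "\<phi> (x', y') < \<phi> (x, y')" "\<phi> (x, y') < \<phi> (x, y)"
    using \<phi> assms by (auto simp: Phi2_def monotone_on_def)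
  then show ?thesis
    by (rule less_trans)
qed

text \<open>The chain is \<open>m \<le> \<phi> (expectation ?Z) \<le> 1\<close>, by power means and
  then by Jensen. If \<open>m = 1\<close>, the second inequality is an equality, and strict
  convexity makes the pair almost surely constant.\<close>

lemma Phi2_power_mean:
  fixes X Y :: "'a \<Rightarrow> real"
  assumes "prob_space M"
    and X: "integrable M X" "AE \<omega> in M. 0 < X \<omega>" "integrable M (\<lambda>\<omega>. X \<omega> ^ p)"
    and Y: "integrable M Y" "AE \<omega> in M. 0 < Y \<omega>" "integrable M (\<lambda>\<omega>. Y \<omega> ^ p)"
    and one: "\<And>\<omega>. \<omega> \<in> space M \<Longrightarrow> \<phi> (X \<omega>, Y \<omega>) = 1" and p: "0 < p"
  defines "m \<equiv> \<phi> ((\<integral>\<omega>. X \<omega> ^ p \<partial>M) powr (1 / real p), (\<integral>\<omega>. Y \<omega> ^ p \<partial>M) powr (1 / real p))"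
  shows "m \<le> 1"
    and "\<lbrakk>ereal_strictly_convex_on ({0<..} \<times> {0<..}) \<phi>; m = 1\<rbrakk>
      \<Longrightarrow> AE \<omega> in M. X \<omega> = (\<integral>\<omega>. X \<omega> \<partial>M) \<and> Y \<omega> = (\<integral>\<omega>. Y \<omega> \<partial>M)"
proof -
  interpret prob_space M by fact
  let ?S = "{0<..} \<times> {0<..} :: (real \<times> real) set"
  let ?f = "\<lambda>z. real_of_ereal (\<phi> z)"
  let ?Z = "\<lambda>\<omega>. (X \<omega>, Y \<omega>)"
  \<comment> \<open>Expanding in the standard basis reduces integrability of the pair to that of its
    components.\<close>
  have "?Z = (\<lambda>\<omega>. X \<omega> *\<^sub>R (1, 0) + Y \<omega> *\<^sub>R (0, 1))"
    by auto
  then have "integrable M ?Z"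
    using X(1) Y(1) by (simp only:) (intro Bochner_Integration.integrable_add integrable_scaleR_left)
  moreover from integral_fst[OF this] integral_snd[OF this]
  have "expectation ?Z = (expectation X, expectation Y)"
    by (simp add: prod_eq_iff)
  ultimately have Z: "integrable M ?Z" "expectation ?Z = (expectation X, expectation Y)" .
  have pos: "0 < expectation X" "0 < expectation Y"
    using X Y by (auto intro: expectation_greater)
  have ZS: "AE \<omega> in M. ?Z \<omega> \<in> ?S" "open ?S" "expectation ?Z \<in> ?S"
    using X(2) Y(2) pos by (auto simp: Z(2) open_Times)
  have fZ: "integrable M (\<lambda>\<omega>. ?f (?Z \<omega>))"
    using one by (subst Bochner_Integration.integrable_cong[OF refl, where g = "\<lambda>_. 1"]) auto
  have Ef: "expectation (\<lambda>\<omega>. ?f (?Z \<omega>)) = 1"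
    using one by (subst Bochner_Integration.integral_cong[OF refl, where g = "\<lambda>_. 1"])
      (auto simp: prob_space)
  note jensen = jensens_inequality_euclidean[OF Z(1) ZS convex_on_Phi2 fZ]
  have power: "expectation W \<le> expectation (\<lambda>\<omega>. W \<omega> ^ p) powr (1 / real p)"
    if W: "integrable M W" "AE \<omega> in M. 0 < W \<omega>" "integrable M (\<lambda>\<omega>. W \<omega> ^ p)" for W :: "'a \<Rightarrow> real"
  proof (rule powr_inverse_power_mean_ge)
    show "0 < expectation W"
      using W by (intro expectation_greater)
    \<comment> \<open>Even powers are convex on the whole line and odd ones on the nonnegative
      half-line; both restrict to the positive half-line.\<close>
    have "convex_on {0<..} (\<lambda>x::real. x ^ p)"
      by (cases "even p")
        (auto intro: convex_on_subset[OF convex_power_even] convex_on_subset[OF convex_power_odd])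
    with W show "expectation W ^ p \<le> expectation (\<lambda>\<omega>. W \<omega> ^ p)"
      by (intro jensens_inequality[where I = "{0<..}" and a = 0]) auto
  qed fact
  \<comment> \<open>Both arguments of \<open>\<phi>\<close> in \<open>m\<close> dominate the means,
    and \<open>\<phi>\<close> is decreasing.\<close>
  have m_le: "m \<le> \<phi> (expectation ?Z)"
    unfolding m_def Z(2) using pos by (intro Phi2_antimono power X Y) auto
  have "?f (expectation ?Z) \<le> 1"
    using jensen(1) Ef by simp
  then have le1: "\<phi> (expectation ?Z) \<le> 1"
    using Phi2_real[OF ZS(3)] by (metis ereal_less_eq(3) one_ereal_def)
  with m_le show "m \<le> 1"
    by (rule order_trans)
  assume strict: "ereal_strictly_convex_on ?S \<phi>" and "m = 1"
  have "\<phi> (expectation ?Z) = 1"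
    using le1 m_le \<open>m = 1\<close> by simp
  then have "AE \<omega> in M. ?Z \<omega> = expectation ?Z"
    using strictly_convex_Phi2_midpoint[OF strict] Ef by (intro jensen(2)) auto
  then show "AE \<omega> in M. X \<omega> = expectation X \<and> Y \<omega> = expectation Y"
    by (simp add: Z(2))
qed

end

section \<open>The chord integral inequality and its equality case\<close>

lemma prob_space_density_sphere_measure:
  fixes w :: "'a::euclidean_space \<Rightarrow> real"
  assumes w: "continuous_on (sphere 0 1) w" "\<And>u. u \<in> sphere 0 1 \<Longrightarrow> 0 \<le> w u"
    and "(\<integral>u. w u \<partial>sphere_measure) = 1"
  shows "prob_space (density sphere_measure (\<lambda>u. ennreal (w u)))"
proof (rule prob_spaceI)
  have "w \<in> borel_measurable sphere_measure"
    by (rule borel_measurable_sphere_measure[OF w(1)])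
  then have "emeasure (density sphere_measure (\<lambda>u. ennreal (w u))) (sphere 0 1)
      = (\<integral>\<^sup>+u. ennreal (w u) * indicator (sphere 0 1) u \<partial>sphere_measure)"
    by (intro emeasure_density) (auto simp: sets_restrict_space)
  also have "\<dots> = (\<integral>\<^sup>+u. ennreal (w u) \<partial>sphere_measure)"
    by (intro nn_integral_cong) simp
  also have "\<dots> = ennreal (\<integral>u. w u \<partial>sphere_measure)"
    using w by (intro nn_integral_eq_integral integrable_sphere_measure AE_I2) auto
  finally show "emeasure (density sphere_measure (\<lambda>u. ennreal (w u)))
      (space (density sphere_measure (\<lambda>u. ennreal (w u)))) = 1"
    using assms by simp
qed

theorem theorem6p2:
  fixes K L P :: "(real ^ 'n) set" and \<phi> :: "real \<times> real \<Rightarrow> ereal" and i :: nat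
  assumes "CARD('n) \<ge> 2"
    and "star_body K" and "star_body L"
    and "i < CARD('n)"
    and "\<phi> \<in> Phi2"
    and "orlicz_chord_sum \<phi> K L P"
  shows "1 \<ge> \<phi> ((chord_integral i K / chord_integral i P) powr (1 / real (CARD('n) - i)),
                (chord_integral i L / chord_integral i P) powr (1 / real (CARD('n) - i)))
    \<and> (ereal_strictly_convex_on ({0<..} \<times> {0<..}) \<phi> \<longrightarrow>
        (1 = \<phi> ((chord_integral i K / chord_integral i P) powr (1 / real (CARD('n) - i)),
                (chord_integral i L / chord_integral i P) powr (1 / real (CARD('n) - i)))
          \<longleftrightarrow> similar_chord K L))"
proof -
  define p where "p = CARD('n) - i"
  have p: "0 < p"
    using assms by (simp add: p_def)
  have P: "star_body P"
    and sum: "\<And>u. u \<in> sphere 0 1 \<Longrightarrow>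
      \<phi> (half_chord K u / half_chord P u, half_chord L u / half_chord P u) = 1"
    using assms(6) by (auto simp: orlicz_chord_sum_def)
  note pos = half_chord_pos[OF P]
  note cont = continuous_on_half_chord[OF P]
  \<comment> \<open>A reference direction: it witnesses \<open>J \<noteq> 0\<close>, and later the
    values of constant quotients are read off there.\<close>
  obtain u0 :: "real ^ 'n" where u0: "u0 \<in> sphere 0 1"
    using that[of "axis undefined 1"] by (simp add: norm_axis_1)
  define J where "J = (\<integral>u. half_chord P u ^ p \<partial>sphere_measure)"
  have J: "0 < J"
  proof -
    have cont': "continuous_on (sphere 0 1) (\<lambda>u. half_chord P u ^ p)"
      by (intro continuous_intros cont)
    have nonneg: "AE u in sphere_measure. 0 \<le> half_chord P u ^ p"
      using pos by (intro AE_I2) (simp add: less_imp_le)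
    \<comment> \<open>If \<open>J\<close> were zero, the continuous integrand would vanish
      everywhere, in particular at \<open>u0\<close>, where it is positive.\<close>
    have "J \<noteq> 0"
      using AE_sphere_measure_imp_all[OF cont' _ u0, of 0] pos[OF u0]
        integral_nonneg_eq_0_iff_AE[OF integrable_sphere_measure[OF cont'] nonneg]
      by (auto simp: J_def)
    moreover have "0 \<le> J"
      unfolding J_def by (intro integral_nonneg_AE nonneg)
    ultimately show ?thesis
      by simp
  qed
  define w where "w u = half_chord P u ^ p / J" for u
  have w: "continuous_on (sphere 0 1) w" "\<And>u. u \<in> sphere 0 1 \<Longrightarrow> 0 < w u"
    unfolding w_def using J pos by (auto intro!: continuous_intros cont)
  define M where "M = density sphere_measure (\<lambda>u. ennreal (w u))"
  have prob: "prob_space M"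
    unfolding M_def using w J
    by (intro prob_space_density_sphere_measure) (auto simp: w_def J_def less_imp_le)
  interpret prob_space M
    by (rule prob)
  have space_M: "space M = sphere 0 1"
    by (simp add: M_def)
  have w_meas: "w \<in> borel_measurable sphere_measure"
    by (rule borel_measurable_sphere_measure[OF w(1)])
  have w_AE: "AE u in sphere_measure. 0 \<le> w u"
    using w(2) by (intro AE_I2) (simp add: less_imp_le)
  have integrable_M: "integrable M f" if f: "continuous_on (sphere 0 1) f"
    for f :: "real ^ 'n \<Rightarrow> real"
    unfolding M_def
    by (subst integrable_real_density[OF w_meas w_AE borel_measurable_sphere_measure[OF f]])
      (intro integrable_sphere_measure continuous_intros w f)
  \<comment> \<open>Since the density \<open>w\<close> is positive on the whole sphere, an
    \<open>M\<close>-almost sure equality also holds almost everywhere for the spherical measure,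
    where continuity applies.\<close>
  have AE_M: "f u = c" if f: "continuous_on (sphere 0 1) f" and ae: "AE u in M. f u = c"
    and u: "u \<in> sphere 0 1" for f :: "real ^ 'n \<Rightarrow> real" and c u
  proof (rule AE_sphere_measure_imp_all[OF f _ u])
    have "AE u in sphere_measure. 0 < w u \<longrightarrow> f u = c"
      using ae unfolding M_def
      by (simp add: AE_density[OF measurable_compose[OF w_meas measurable_ennreal]])
    moreover have "AE u in sphere_measure. 0 < w u"
      using w(2) by (intro AE_I2) simp
    ultimately show "AE u in sphere_measure. f u = c"
      by eventually_elim simp
  qed
  define q where "q Q u = half_chord Q u / half_chord P u" for Q u
  have q_cont: "continuous_on (sphere 0 1) (q Q)" and q_pos: "\<And>u. u \<in> sphere 0 1 \<Longrightarrow> 0 < q Q u"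
    if "star_body Q" for Q
    unfolding q_def using that P pos
    by (auto intro!: continuous_intros cont continuous_on_half_chord half_chord_pos divide_pos_pos
        simp: less_imp_neq[symmetric])
  have ratio: "chord_integral i Q / chord_integral i P = (\<integral>u. q Q u ^ p \<partial>M)"
    if Q: "star_body Q" for Q
  proof -
    have "(\<integral>u. q Q u ^ p \<partial>M) = (\<integral>u. w u *\<^sub>R q Q u ^ p \<partial>sphere_measure)"
      unfolding M_def
      by (intro integral_density borel_measurable_sphere_measure continuous_intros q_cont Q w_meas w_AE)
    \<comment> \<open>The weight contains the power of \<open>half_chord P\<close> that
      \<open>q Q\<close> has in its denominator, so it cancels; the dimension factor of the chord
      integrals cancels in their ratio.\<close>
    also have "\<dots> = (\<integral>u. half_chord Q u ^ p / J \<partial>sphere_measure)"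
      using pos by (intro Bochner_Integration.integral_cong refl)
        (auto simp: w_def q_def power_divide less_imp_neq[symmetric])
    finally show ?thesis
      by (simp add: chord_integral_def J_def p_def)
  qed
  have sum': "\<phi> (q K u, q L u) = 1" if "u \<in> sphere 0 1" for u
    using sum[OF that] by (simp add: q_def)
  have integ: "integrable M (q Q)" "AE u in M. 0 < q Q u" "integrable M (\<lambda>u. q Q u ^ p)"
    if Q: "star_body Q" for Q
    using q_pos[OF Q] by (auto intro!: integrable_M continuous_intros q_cont Q AE_I2 simp: space_M)
  define m where "m = \<phi> ((\<integral>u. q K u ^ p \<partial>M) powr (1 / real p), (\<integral>u. q L u ^ p \<partial>M) powr (1 / real p))"
  note mean = Phi2_power_mean[OF assms(5) prob integ[OF assms(2)] integ[OF assms(3)] sum' p,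
      folded m_def, unfolded space_M]
  have "m = 1 \<longleftrightarrow> similar_chord K L" if strict: "ereal_strictly_convex_on ({0<..} \<times> {0<..}) \<phi>"
  proof
    assume "m = 1"
    then have ae: "AE u in M. q K u = expectation (q K) \<and> q L u = expectation (q L)"
      using mean(2) strict by blast
    have q_const: "q K u = expectation (q K)" "q L u = expectation (q L)" if "u \<in> sphere 0 1" for u
      using ae that by (auto intro!: AE_M q_cont assms)
    have e_pos: "0 < expectation (q K)" "0 < expectation (q L)"
      using q_const[OF u0] q_pos[OF _ u0] assms by metis+
    show "similar_chord K L"
      unfolding similar_chord_def
    proof (intro exI conjI ballI)
      fix u :: "real ^ 'n" assume u: "u \<in> sphere 0 1"
      \<comment> \<open>Both quotients by \<open>half_chord P\<close> are constant, so the ratio of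
        the two constants is the similarity factor.\<close>
      show "half_chord K u = expectation (q K) / expectation (q L) * half_chord L u"
        using q_const[OF u] pos[OF u] e_pos half_chord_pos[OF assms(3) u]
        by (simp add: q_def field_simps)
    qed (use e_pos in simp)
  next
    assume "similar_chord K L"
    then obtain c where c: "0 < c" "\<And>u. u \<in> sphere 0 1 \<Longrightarrow> half_chord K u = c * half_chord L u"
      by (auto simp: similar_chord_def)
    have qK: "q K u = c * q L u" if "u \<in> sphere 0 1" for u
      using c(2)[OF that] by (simp add: q_def)
    \<comment> \<open>A strict increase of \<open>q L\<close> forces one of
      \<open>q K = c * q L\<close>, so \<open>\<phi>\<close> would strictly decrease although it
      equals \<open>1\<close> at both directions. Applied in both orders, this makes
      \<open>q L\<close> constant.\<close>
    have not_less: "\<not> q L u < q L v" if "u \<in> sphere 0 1" "v \<in> sphere 0 1" for u v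
    proof
      assume "q L u < q L v"
      then have "\<phi> (q K v, q L v) < \<phi> (q K u, q L u)"
        using that c(1) q_pos assms by (intro Phi2_strict_antimono) (auto simp: qK)
      then show False
        using sum' that by simp
    qed
    have const: "q L u = q L u0" "q K u = q K u0" if "u \<in> sphere 0 1" for u
      using not_less[OF that u0] not_less[OF u0 that] qK[OF that] qK[OF u0] by simp_all
    \<comment> \<open>The power mean of a positive constant under a probability measure is that
      constant, so \<open>m\<close> becomes the value of \<open>\<phi>\<close> at
      \<open>u0\<close>.\<close>
    have "(\<integral>u. q Q u ^ p \<partial>M) powr (1 / real p) = q Q u0"
      if Q: "star_body Q" "\<And>u. u \<in> sphere 0 1 \<Longrightarrow> q Q u = q Q u0" for Q
    proof -
      have "(\<integral>u. q Q u ^ p \<partial>M) = (\<integral>u. q Q u0 ^ p \<partial>M)"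
        using Q(2) by (intro Bochner_Integration.integral_cong refl) (metis space_M)
      then show ?thesis
        using q_pos[OF Q(1) u0] p by (simp add: prob_space powr_powr flip: powr_realpow)
    qed
    then show "m = 1"
      using assms(2,3) const sum'[OF u0] by (simp add: m_def)
  qed
  with mean(1) show ?thesis
    using ratio[OF assms(2)] ratio[OF assms(3)] by (auto simp: m_def p_def)
qed

end
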